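(* Let $M\le K\le N$ be positive integers and $\varepsilon>0$. Let $\mathcal{U}=\{U_q\}_{q=1}^Q$ be a finite group of $M\times M$ real orthogonal matrices, and let $\{\varphi_n\}_{n=1}^N\subseteq\mathbb{R}^M$ be $\mathcal{U}$-invariant. Choose any $\{\psi_r\}_{r=1}^R\subseteq\mathbb{S}^{M-1}$ such that the family $\{U_q\psi_r\}_{q=1,\,r=1}^{Q,\ \ R}$ is an $\varepsilon$-net for $\mathbb{S}^{M-1}$. Then the $\varepsilon$-approximate NERF bounds $\alpha_{K,\varepsilon},\beta_{K,\varepsilon}$ of $\{\varphi_n\}_{n=1}^N$ corresponding to the $\varepsilon$-net $\{U_q\psi_r\}_{q=1,\,r=1}^{Q,\ \ R}$ can be computed as $$\alpha_{K,\varepsilon}=\min_{r=1,\dots,R}\ \sum_{n=1}^K|\langle\psi_r,\varphi_{\sigma(n)}\rangle|^2,\qquad \beta_{K,\varepsilon}=\max_{r=1,\dots,R}\ \sum_{n=N-K+1}^N|\langle\psi_r,\varphi_{\sigma(n)}\rangle|^2,$$ where the $r$-dependent permutation $\sigma$ of $\{1,\dots,N\}$ is chosen so that the values $|\langle\psi_r,\varphi_{\sigma(n)}\rangle|^2$, $n=1,\dots,N$, are arranged in nondecreasing order.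
   Context: $\mathbb{S}^{M-1}$ is the Euclidean unit sphere in $\mathbb{R}^M$, with standard inner product $\langle\cdot,\cdot\rangle$. $\{\varphi_n\}_{n=1}^N$ is $\mathcal{U}$-invariant if for every $q=1,\dots,Q$ there exists a permutation $\sigma$ of $\{1,\dots,N\}$ such that $U_q\varphi_n=\pm\varphi_{\sigma(n)}$ for all $n=1,\dots,N$ (the sign may depend on $q$ and $n$). A finite family $\{\theta_p\}_{p=1}^P\subseteq\mathbb{S}^{M-1}$ is an $\varepsilon$-net for $\mathbb{S}^{M-1}$ if for every $x\in\mathbb{S}^{M-1}$ there exists $p$ such that $|\langle x,\theta_p\rangle|^2\ge 1-\varepsilon^2$. Given an $\varepsilon$-net $\{\theta_p\}_{p=1}^P$, the corresponding $\varepsilon$-approximate lower and upper NERF (numerically erasure-robust frame) bounds of $\{\varphi_n\}_{n=1}^N$ are $$\alpha_{K,\varepsilon}:=\min_{p=1,\dots,P}\ \sum_{n=1}^K|\langle\theta_p,\varphi_{\sigma(n)}\rangle|^2,\qquad \beta_{K,\varepsilon}:=\max_{p=1,\dots,P}\ \sum_{n=N-K+1}^N|\langle\theta_p,\varphi_{\sigma(n)}\rangle|^2,$$ where $\sigma$ is a $p$-dependent permutation of $\{1,\dots,N\}$ chosen so that the values $|\langle\theta_p,\varphi_{\sigma(n)}\rangle|^2$, $n=1,\dots,N$, are in nondecreasing order. *)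

theory Defs
  imports "HOL-Analysis.Analysis" "HOL-Algebra.Group" "HOL-Combinatorics.Permutations"
begin

definition orthogonal_matrix_group :: "(real ^ 'm ^ 'm) set \<Rightarrow> bool" where
  "orthogonal_matrix_group G \<longleftrightarrow>
     group \<lparr>carrier = G, mult = (**), one = mat 1\<rparr> \<and> (\<forall>A\<in>G. orthogonal_matrix A)"

definition invariant_family ::
  "nat \<Rightarrow> (nat \<Rightarrow> real ^ 'm ^ 'm) \<Rightarrow> nat \<Rightarrow> (nat \<Rightarrow> real ^ 'm) \<Rightarrow> bool" where
  "invariant_family Q U N \<phi> \<longleftrightarrow>
     (\<forall>q\<in>{1..Q}. \<exists>\<sigma>. \<sigma> permutes {1..N} \<and>
        (\<forall>n\<in>{1..N}. U q *v \<phi> n = \<phi> (\<sigma> n) \<or> U q *v \<phi> n = - \<phi> (\<sigma> n)))"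

text \<open>The index set of a net is arbitrary, so that doubly indexed families
  are covered without renumbering.\<close>

definition eps_net :: "real \<Rightarrow> 'i set \<Rightarrow> ('i \<Rightarrow> real ^ 'm) \<Rightarrow> bool" where
  "eps_net \<epsilon> I \<theta> \<longleftrightarrow>
     finite I \<and> (\<forall>p\<in>I. \<theta> p \<in> sphere 0 1) \<and>
     (\<forall>x\<in>sphere 0 1. \<exists>p\<in>I. \<bar>x \<bullet> \<theta> p\<bar>\<^sup>2 \<ge> 1 - \<epsilon>\<^sup>2)"

definition sorting_perm :: "nat \<Rightarrow> (nat \<Rightarrow> real) \<Rightarrow> (nat \<Rightarrow> nat) \<Rightarrow> bool" where
  "sorting_perm N v \<sigma> \<longleftrightarrow> \<sigma> permutes {1..N} \<and> mono_on {1..N} (\<lambda>n. v (\<sigma> n))"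

lemma sorting_perm_exists: "\<exists>\<sigma>. sorting_perm N v \<sigma>"
proof -
  define xs where "xs = sort_key v [1..<Suc N]"
  define \<sigma> where "\<sigma> n = (if n \<in> {1..N} then xs ! (n - 1) else n)" for n
  have len: "length xs = N" and dist: "distinct xs" and set: "set xs = {1..N}"
    and srt: "sorted (map v xs)"
    by (auto simp: xs_def)
  have "inj_on \<sigma> {1..N}"
    using dist len by (auto simp: inj_on_def \<sigma>_def nth_eq_iff_index_eq)
  moreover have "\<sigma> ` {1..N} \<subseteq> {1..N}"
  proof
    fix y assume "y \<in> \<sigma> ` {1..N}"
    then obtain n where n: "n \<in> {1..N}" "y = xs ! (n - 1)"
      by (auto simp: \<sigma>_def)
    then have "y \<in> set xs"
      using len by (auto intro!: nth_mem)
    then show "y \<in> {1..N}"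
      using set by simp
  qed
  ultimately have "bij_betw \<sigma> {1..N} {1..N}"
    by (simp add: bij_betw_def endo_inj_surj)
  then have "\<sigma> permutes {1..N}"
    by (rule bij_imp_permutes) (auto simp: \<sigma>_def)
  moreover have "mono_on {1..N} (\<lambda>n. v (\<sigma> n))"
  proof (rule mono_onI)
    fix m n assume "m \<in> {1..N}" "n \<in> {1..N}" "m \<le> n"
    then show "v (\<sigma> m) \<le> v (\<sigma> n)"
      using sorted_nth_mono[OF srt, of "m - 1" "n - 1"] len by (auto simp: \<sigma>_def)
  qed
  ultimately show ?thesis
    unfolding sorting_perm_def by blast
qed

lemma sorting_perm_map:
  assumes "sorting_perm N v \<sigma>"
  shows "map (\<lambda>n. v (\<sigma> n)) [1..<Suc N] = sort (map v [1..<Suc N])"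
proof -
  have "image_mset \<sigma> (mset_set {1..N}) = mset_set {1..N}"
    using assms by (simp add: sorting_perm_def permutes_image_mset)
  then have "mset (map \<sigma> [1..<Suc N]) = mset [1..<Suc N]"
    by (simp add: atLeastLessThanSuc_atLeastAtMost del: upt_Suc)
  then have "image_mset v (mset (map \<sigma> [1..<Suc N])) = image_mset v (mset [1..<Suc N])"
    by (rule arg_cong)
  then have "mset (map (\<lambda>n. v (\<sigma> n)) [1..<Suc N]) = mset (map v [1..<Suc N])"
    by (simp add: multiset.map_comp comp_def del: upt_Suc)
  moreover have "sorted (map (\<lambda>n. v (\<sigma> n)) [1..<Suc N])"
    using assms
    by (auto simp: sorting_perm_def sorted_iff_nth_mono intro: mono_onD simp del: upt_Suc)
  ultimately show ?thesis
    by (rule properties_for_sort[symmetric])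
qed

lemma sorting_perm_unique:
  assumes "sorting_perm N v \<sigma>" "sorting_perm N v \<tau>" "n \<in> {1..N}"
  shows "v (\<sigma> n) = v (\<tau> n)"
proof -
  have "map (\<lambda>n. v (\<sigma> n)) [1..<Suc N] = map (\<lambda>n. v (\<tau> n)) [1..<Suc N]"
    using assms(1,2) by (simp only: sorting_perm_map)
  then show ?thesis
    using assms(3) by (simp del: upt_Suc)
qed

text \<open>In the two bounds below, \<open>I\<close> and \<open>\<theta>\<close> are the net, which is the only place where
  the tolerance enters. The arbitrarily selected sorting permutation exists by
  \<open>sorting_perm_exists\<close>, and \<open>sorting_perm_unique\<close> makes the bounds independent of
  the selection for \<open>K \<le> N\<close>. \<open>Min\<close> and \<open>Max\<close> are meaningful since nets are finite
  and nonempty.\<close>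

definition lower_nerf_bound ::
  "'i set \<Rightarrow> ('i \<Rightarrow> real ^ 'm) \<Rightarrow> nat \<Rightarrow> (nat \<Rightarrow> real ^ 'm) \<Rightarrow> nat \<Rightarrow> real" where
  "lower_nerf_bound I \<theta> N \<phi> K =
     Min ((\<lambda>p. let \<sigma> = (SOME \<sigma>. sorting_perm N (\<lambda>n. \<bar>\<theta> p \<bullet> \<phi> n\<bar>\<^sup>2) \<sigma>)
               in \<Sum>n=1..K. \<bar>\<theta> p \<bullet> \<phi> (\<sigma> n)\<bar>\<^sup>2) ` I)"

definition upper_nerf_bound ::
  "'i set \<Rightarrow> ('i \<Rightarrow> real ^ 'm) \<Rightarrow> nat \<Rightarrow> (nat \<Rightarrow> real ^ 'm) \<Rightarrow> nat \<Rightarrow> real" where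
  "upper_nerf_bound I \<theta> N \<phi> K =
     Max ((\<lambda>p. let \<sigma> = (SOME \<sigma>. sorting_perm N (\<lambda>n. \<bar>\<theta> p \<bullet> \<phi> n\<bar>\<^sup>2) \<sigma>)
               in \<Sum>n=N - K + 1..N. \<bar>\<theta> p \<bullet> \<phi> (\<sigma> n)\<bar>\<^sup>2) ` I)"

end

theory Submission
  imports Defs
begin

text \<open>Orthogonality of \<open>U\<^sub>q\<close> gives
  \<open>\<bar>\<psi> \<bullet> \<phi>\<^sub>n\<bar> = \<bar>U\<^sub>q \<psi> \<bullet> U\<^sub>q \<phi>\<^sub>n\<bar> = \<bar>U\<^sub>q \<psi> \<bullet> \<phi>\<^bsub>\<tau>(n)\<^esub>\<bar>\<close> for the permutation \<open>\<tau>\<close>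
  by which \<open>U\<^sub>q\<close> acts on the family up to sign. Hence all points of the orbit of \<open>\<psi>\<close> produce
  the same sorted list of squared coefficients, and the minimum and maximum over
  the net reduce to one representative per orbit.\<close>

lemma orthogonal_matrix_inner:
  fixes A :: "real ^ 'n ^ 'n"
  assumes "orthogonal_matrix A"
  shows "(A *v x) \<bullet> (A *v y) = x \<bullet> y"
  using assms orthogonal_transformation_matrix[of "(*v) A"]
  by (simp add: orthogonal_transformation_def)

text \<open>Since \<open>w\<close> is \<open>v\<close> relabelled along \<open>\<tau>\<close>, the
  values of \<open>w\<close> along \<open>\<tau> \<circ> \<sigma>\<close> are those of
  \<open>v\<close> along \<open>\<sigma>\<close>, already in order.\<close>

lemma sorting_perm_comp:
  assumes "sorting_perm N v \<sigma>" and "\<tau> permutes {1..N}"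
    and "\<And>n. n \<in> {1..N} \<Longrightarrow> w (\<tau> n) = v n"
  shows "sorting_perm N w (\<tau> \<circ> \<sigma>)"
proof -
  have \<sigma>: "\<sigma> permutes {1..N}" and mono: "mono_on {1..N} (\<lambda>n. v (\<sigma> n))"
    using assms(1) by (auto simp: sorting_perm_def)
  have "w (\<tau> (\<sigma> n)) = v (\<sigma> n)" if "n \<in> {1..N}" for n
    using assms(3) permutes_in_image[OF \<sigma>] that by blast
  then have "mono_on {1..N} (\<lambda>n. w ((\<tau> \<circ> \<sigma>) n))"
    using mono by (auto simp: mono_on_def)
  then show ?thesis
    using permutes_compose[OF \<sigma> assms(2)] by (simp add: sorting_perm_def)
qed

text \<open>With ties, \<open>\<rho>\<close> may differ from \<open>\<tau> \<circ> \<sigma>\<close>,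
  but both sort \<open>w\<close>, so uniqueness of the sorted values lets one replace the
  other.\<close>

lemma sorting_perm_eq:
  assumes "sorting_perm N v \<sigma>" and "sorting_perm N w \<rho>" and "\<tau> permutes {1..N}"
    and "\<And>n. n \<in> {1..N} \<Longrightarrow> w (\<tau> n) = v n" and "n \<in> {1..N}"
  shows "w (\<rho> n) = v (\<sigma> n)"
proof -
  have "w (\<rho> n) = w ((\<tau> \<circ> \<sigma>) n)"
    using assms(2) sorting_perm_comp[OF assms(1,3,4)] assms(5) by (rule sorting_perm_unique)
  moreover have "\<sigma> n \<in> {1..N}"
    using assms(1,5) permutes_in_image by (fastforce simp: sorting_perm_def)
  ultimately show ?thesis
    using assms(4) by simp
qed

lemma invariant_family_sorted_eq:
  assumes "invariant_family Q U N \<phi>" and "q \<in> {1..Q}" and "orthogonal_matrix (U q)"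
    and "sorting_perm N (\<lambda>n. \<bar>x \<bullet> \<phi> n\<bar>\<^sup>2) \<sigma>"
    and "sorting_perm N (\<lambda>n. \<bar>(U q *v x) \<bullet> \<phi> n\<bar>\<^sup>2) \<rho>"
    and "n \<in> {1..N}"
  shows "\<bar>(U q *v x) \<bullet> \<phi> (\<rho> n)\<bar>\<^sup>2 = \<bar>x \<bullet> \<phi> (\<sigma> n)\<bar>\<^sup>2"
proof -
  obtain \<tau> where \<tau>: "\<tau> permutes {1..N}"
    and U: "\<And>n. n \<in> {1..N} \<Longrightarrow> U q *v \<phi> n = \<phi> (\<tau> n) \<or> U q *v \<phi> n = - \<phi> (\<tau> n)"
    using assms(1,2) unfolding invariant_family_def by blast
  \<comment> \<open>The absolute value absorbs the sign, which may vary with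
    \<open>n\<close>.\<close>
  have "\<bar>(U q *v x) \<bullet> \<phi> (\<tau> n)\<bar>\<^sup>2 = \<bar>x \<bullet> \<phi> n\<bar>\<^sup>2" if "n \<in> {1..N}" for n
    using U[OF that] orthogonal_matrix_inner[OF assms(3), of x "\<phi> n"]
    by (metis abs_minus_cancel inner_minus_right)
  then show ?thesis
    using sorting_perm_eq[OF assms(4,5) \<tau>] assms(6) by simp
qed

theorem theorem3:
  fixes K N Q R :: nat and \<epsilon> :: real
    and U :: "nat \<Rightarrow> real ^ 'm ^ 'm"
    and \<phi> \<psi> :: "nat \<Rightarrow> real ^ 'm"
    and \<sigma> :: "nat \<Rightarrow> nat \<Rightarrow> nat"
  assumes "CARD('m) \<le> K" and "K \<le> N" and "\<epsilon> > 0"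
    and "orthogonal_matrix_group (U ` {1..Q})"
    and "invariant_family Q U N \<phi>"
    and "\<forall>r\<in>{1..R}. \<psi> r \<in> sphere 0 1"
    and "eps_net \<epsilon> ({1..Q} \<times> {1..R}) (\<lambda>(q, r). U q *v \<psi> r)"
    and "\<forall>r\<in>{1..R}. sorting_perm N (\<lambda>n. \<bar>\<psi> r \<bullet> \<phi> n\<bar>\<^sup>2) (\<sigma> r)"
  shows "lower_nerf_bound ({1..Q} \<times> {1..R}) (\<lambda>(q, r). U q *v \<psi> r) N \<phi> K
           = Min ((\<lambda>r. \<Sum>n=1..K. \<bar>\<psi> r \<bullet> \<phi> (\<sigma> r n)\<bar>\<^sup>2) ` {1..R})
       \<and> upper_nerf_bound ({1..Q} \<times> {1..R}) (\<lambda>(q, r). U q *v \<psi> r) N \<phi> K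
           = Max ((\<lambda>r. \<Sum>n=N - K + 1..N. \<bar>\<psi> r \<bullet> \<phi> (\<sigma> r n)\<bar>\<^sup>2) ` {1..R})"
proof -
  \<comment> \<open>A group contains its identity, so every \<open>r\<close> occurs in some pair
    \<open>(q, r)\<close>; for \<open>Q = 0\<close> the product would be empty and the images below
    could differ.\<close>
  have "{1..Q} \<noteq> {}"
    using assms(4) monoid.one_closed[OF group.is_monoid]
    by (fastforce simp: orthogonal_matrix_group_def)
  then have orbits: "f ` ({1..Q} \<times> {1..R}) = g ` {1..R}"
    if "\<And>q r. \<lbrakk>q \<in> {1..Q}; r \<in> {1..R}\<rbrakk> \<Longrightarrow> f (q, r) = g r"
    for f :: "nat \<times> nat \<Rightarrow> real" and g
    using that by force
  \<comment> \<open>A general \<open>J\<close> covers both the \<open>K\<close> smallest and the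
    \<open>K\<close> largest values.\<close>
  have sums: "(let \<rho> = SOME \<rho>. sorting_perm N (\<lambda>n. \<bar>(U q *v \<psi> r) \<bullet> \<phi> n\<bar>\<^sup>2) \<rho>
      in \<Sum>n\<in>J. \<bar>(U q *v \<psi> r) \<bullet> \<phi> (\<rho> n)\<bar>\<^sup>2) = (\<Sum>n\<in>J. \<bar>\<psi> r \<bullet> \<phi> (\<sigma> r n)\<bar>\<^sup>2)"
    if "q \<in> {1..Q}" "r \<in> {1..R}" "J \<subseteq> {1..N}" for q r J
  proof -
    have "orthogonal_matrix (U q)"
      using assms(4) that(1) by (simp add: orthogonal_matrix_group_def)
    moreover have "sorting_perm N (\<lambda>n. \<bar>\<psi> r \<bullet> \<phi> n\<bar>\<^sup>2) (\<sigma> r)"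
      using assms(8) that(2) by blast
    ultimately show ?thesis
      unfolding Let_def using that(3)
      \<comment> \<open>\<open>someI_ex\<close> certifies that the permutation selected in the
        bounds really sorts, after which the sums agree term by term.\<close>
      by (intro sum.cong refl
          invariant_family_sorted_eq[OF assms(5) that(1) _ _ someI_ex[OF sorting_perm_exists]]) auto
  qed
  \<comment> \<open>\<open>K \<le> N\<close> places \<open>{1..K}\<close> inside
    \<open>{1..N}\<close>. The two sets of sums coincide, hence so do their extrema.\<close>
  show ?thesis
    unfolding lower_nerf_bound_def upper_nerf_bound_def
    using \<open>K \<le> N\<close>
    by (intro conjI arg_cong[where f = Min] arg_cong[where f = Max] orbits)
      (simp_all only: prod.case, (rule sums; auto)+)
qed

end
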